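(* Let $V:S^{n-1}\to S^{n-1}$ be a $b$-bistochastic quadratic stochastic operator for which $\mathbb{P}=(0,\dots,0,1)$ is the unique fixed point. Then for every $\mathbf{x}\in \mathrm{ri}\,S^{n-1}$ the measure $\mu_{V,\mathbf{x}}$ satisfies the mixing property, i.e. for all $A,B\in\mathfrak{F}$, $$\lim_{m\to\infty}\left|\mu_{V,\mathbf{x}}\big(A\cap\sigma^{-m}(B)\big)-\mu_{V,\mathbf{x}}(A)\,\mu_{V,\mathbf{x}}\big(\sigma^{-m}(B)\big)\right|=0.$$
   Context: $S^{n-1}=\{\mathbf{x}=(x_1,\dots,x_n)\in\mathbb{R}^n : x_i\ge 0,\ \sum_{i=1}^n x_i=1\}$ and $\mathrm{ri}\,S^{n-1}=\{\mathbf{x}\in S^{n-1}: x_1x_2\cdots x_n\neq 0\}$. For $\mathbf{x},\mathbf{y}\in S^{n-1}$ write $\mathbf{x}\le^b\mathbf{y}$ if $\sum_{i=1}^k x_i\le\sum_{i=1}^k y_i$ for all $k\in\{1,\dots,n-1\}$. A quadratic stochastic operator (q.s.o.) is a map $V:S^{n-1}\to S^{n-1}$ of the form $V(\mathbf{x})_k=\sum_{i,j=1}^n P_{ij,k}x_ix_j$, $k=1,\dots,n$, where the heredity coefficients satisfy $P_{ij,k}\ge 0$, $P_{ij,k}=P_{ji,k}$ and $\sum_{k=1}^n P_{ij,k}=1$ for all $i,j,k$. A q.s.o. $V$ is called $b$-bistochastic if $V(\mathbf{x})\le^b\mathbf{x}$ for all $\mathbf{x}\in S^{n-1}$; then $\mathbb{P}=(0,\dots,0,1)$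 is always a fixed point of $V$. Let $\Omega=\prod_{i=0}^\infty E_i$ with $E_i=\{1,\dots,n\}$, let $\mathfrak{F}$ be the $\sigma$-algebra generated by the thin cylindrical sets $A^{[l,m]}(i_l,\dots,i_m)=\{\omega\in\Omega:\omega_l=i_l,\dots,\omega_m=i_m\}$, and let $\sigma:\Omega\to\Omega$ be the shift, $\sigma(\omega)_k=\omega_{k+1}$. For a q.s.o. $V$ and $\mathbf{x}\in S^{n-1}$ put $x_j^{(k)}=(V^{(k)}(\mathbf{x}))_j$, where $V^{(k)}$ is the $k$-th iterate of $V$ ($V^{(0)}=\mathrm{id}$), and $$H_{ij,\mathbf{x}}^{[k,k+1]}=\sum_{l=1}^n P_{il,j}\,x_l^{(k)},\qquad i,j\in\{1,\dots,n\},\ k\ge 0;$$ these are stochastic matrices. The non-homogeneous Markov measure $\mu_{V,\mathbf{x}}$ on $(\Omega,\mathfrak{F})$ associated with $V$ and $\mathbf{x}$ is the probability measure determined by $$\mu_{V,\mathbf{x}}\big(A^{[k,m]}(i_k,\dots,i_m)\big)=x_{i_k}^{(k)}H_{i_ki_{k+1},\mathbf{x}}^{[k,k+1]}H_{i_{k+1}i_{k+2},\mathbf{x}}^{[k+1,k+2]}\cdots H_{i_{m-1}i_m,\mathbf{x}}^{[m-1,m]}.$$ *)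

theory Defs
  imports "HOL-Probability.Probability"
begin

text \<open>
  Vectors of \<open>\<real>\<^sup>n\<close> are functions \<open>nat \<Rightarrow> real\<close> with coordinates \<open>1, \<dots>, n\<close>. Points of
  the simplex are required to vanish outside \<open>{1..n}\<close>, so that equality of functions is
  equality of points (this matters for fixed points).
\<close>

definition std_simplex :: "nat \<Rightarrow> (nat \<Rightarrow> real) set" where
  "std_simplex n = {x. (\<forall>i. i \<notin> {1..n} \<longrightarrow> x i = 0) \<and> (\<forall>i\<in>{1..n}. 0 \<le> x i) \<and> (\<Sum>i=1..n. x i) = 1}"

definition ri_simplex :: "nat \<Rightarrow> (nat \<Rightarrow> real) set" where
  "ri_simplex n = {x \<in> std_simplex n. (\<Prod>i=1..n. x i) \<noteq> 0}"

definition last_vertex :: "nat \<Rightarrow> nat \<Rightarrow> real" where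
  "last_vertex n = (\<lambda>i. if i = n then 1 else 0)"

definition b_le :: "nat \<Rightarrow> (nat \<Rightarrow> real) \<Rightarrow> (nat \<Rightarrow> real) \<Rightarrow> bool" where
  "b_le n x y \<longleftrightarrow> (\<forall>k\<in>{1..n-1}. (\<Sum>i=1..k. x i) \<le> (\<Sum>i=1..k. y i))"

text \<open>\<open>P i j k\<close> stands for the heredity coefficient \<open>P\<^sub>i\<^sub>j\<^sub>,\<^sub>k\<close>.\<close>

definition heredity :: "nat \<Rightarrow> (nat \<Rightarrow> nat \<Rightarrow> nat \<Rightarrow> real) \<Rightarrow> bool" where
  "heredity n P \<longleftrightarrow>
     (\<forall>i\<in>{1..n}. \<forall>j\<in>{1..n}.
        (\<forall>k\<in>{1..n}. 0 \<le> P i j k \<and> P i j k = P j i k) \<and> (\<Sum>k=1..n. P i j k) = 1)"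

definition qso :: "nat \<Rightarrow> (nat \<Rightarrow> nat \<Rightarrow> nat \<Rightarrow> real) \<Rightarrow> (nat \<Rightarrow> real) \<Rightarrow> (nat \<Rightarrow> real)" where
  "qso n P x = (\<lambda>k. if k \<in> {1..n} then \<Sum>i=1..n. \<Sum>j=1..n. P i j k * x i * x j else 0)"

definition b_bistochastic :: "nat \<Rightarrow> ((nat \<Rightarrow> real) \<Rightarrow> (nat \<Rightarrow> real)) \<Rightarrow> bool" where
  "b_bistochastic n V \<longleftrightarrow> (\<forall>x\<in>std_simplex n. b_le n (V x) x)"

definition qso_orbit ::
    "nat \<Rightarrow> (nat \<Rightarrow> nat \<Rightarrow> nat \<Rightarrow> real) \<Rightarrow> (nat \<Rightarrow> real) \<Rightarrow> nat \<Rightarrow> (nat \<Rightarrow> real)" where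
  "qso_orbit n P x k = (qso n P ^^ k) x"

text \<open>\<open>transition n P x k i j\<close> is the matrix entry \<open>H\<^sub>i\<^sub>j\<^sub>,\<^sub>x\<close> for the step from time \<open>k\<close> to time \<open>k + 1\<close>.\<close>

definition transition ::
    "nat \<Rightarrow> (nat \<Rightarrow> nat \<Rightarrow> nat \<Rightarrow> real) \<Rightarrow> (nat \<Rightarrow> real) \<Rightarrow> nat \<Rightarrow> nat \<Rightarrow> nat \<Rightarrow> real" where
  "transition n P x k i j = (\<Sum>l=1..n. P i l j * qso_orbit n P x k l)"

definition path_set :: "nat \<Rightarrow> (nat \<Rightarrow> nat) set" where
  "path_set n = UNIV \<rightarrow> {1..n}"

text \<open>Only the values of \<open>a\<close> on \<open>{l..m}\<close> matter: \<open>a j\<close> is the prescribed state at time \<open>j\<close>.\<close>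

definition cylinder :: "nat \<Rightarrow> nat \<Rightarrow> nat \<Rightarrow> (nat \<Rightarrow> nat) \<Rightarrow> (nat \<Rightarrow> nat) set" where
  "cylinder n l m a = {\<omega> \<in> path_set n. \<forall>j\<in>{l..m}. \<omega> j = a j}"

definition thin_cylinders :: "nat \<Rightarrow> (nat \<Rightarrow> nat) set set" where
  "thin_cylinders n = {cylinder n l m a | l m a. l \<le> m \<and> a \<in> {l..m} \<rightarrow> {1..n}}"

definition path_algebra :: "nat \<Rightarrow> (nat \<Rightarrow> nat) set set" where
  "path_algebra n = sigma_sets (path_set n) (thin_cylinders n)"

definition shift :: "(nat \<Rightarrow> nat) \<Rightarrow> (nat \<Rightarrow> nat)" where
  "shift \<omega> = (\<lambda>k. \<omega> (Suc k))"

definition shift_preimage :: "nat \<Rightarrow> nat \<Rightarrow> (nat \<Rightarrow> nat) set \<Rightarrow> (nat \<Rightarrow> nat) set" where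
  "shift_preimage n m B = (shift ^^ m) -` B \<inter> path_set n"

definition is_markov_measure ::
    "nat \<Rightarrow> (nat \<Rightarrow> nat \<Rightarrow> nat \<Rightarrow> real) \<Rightarrow> (nat \<Rightarrow> real) \<Rightarrow> (nat \<Rightarrow> nat) measure \<Rightarrow> bool" where
  "is_markov_measure n P x M \<longleftrightarrow>
     prob_space M \<and> space M = path_set n \<and> sets M = path_algebra n \<and>
     (\<forall>k m a. k \<le> m \<longrightarrow> a \<in> {k..m} \<rightarrow> {1..n} \<longrightarrow>
        measure M (cylinder n k m a) =
          qso_orbit n P x k (a k) * (\<Prod>j\<in>{k..<m}. transition n P x j (a j) (a (Suc j))))"

text \<open>
  The definite description is justified by \<open>is_markov_measure_markov_measure\<close> at the end of
  this theory, i.e. existence and uniqueness of the measure.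
\<close>

definition markov_measure ::
    "nat \<Rightarrow> (nat \<Rightarrow> nat \<Rightarrow> nat \<Rightarrow> real) \<Rightarrow> (nat \<Rightarrow> real) \<Rightarrow> (nat \<Rightarrow> nat) measure" where
  "markov_measure n P x = (THE M. is_markov_measure n P x M)"


subsection \<open>Existence and uniqueness of the Markov measure\<close>

lemma qso_in_std_simplex:
  assumes P: "heredity n P" and x: "x \<in> std_simplex n"
  shows "qso n P x \<in> std_simplex n"
proof -
  have nn: "0 \<le> qso n P x k" for k
    using P x unfolding heredity_def std_simplex_def qso_def
    by (auto intro!: sum_nonneg mult_nonneg_nonneg)
  have "(\<Sum>k=1..n. qso n P x k) = (\<Sum>k=1..n. \<Sum>i=1..n. \<Sum>j=1..n. P i j k * x i * x j)"
    by (intro sum.cong) (auto simp: qso_def)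
  also have "\<dots> = (\<Sum>i=1..n. \<Sum>k=1..n. \<Sum>j=1..n. P i j k * x i * x j)"
    by (rule sum.swap)
  also have "\<dots> = (\<Sum>i=1..n. \<Sum>j=1..n. \<Sum>k=1..n. P i j k * x i * x j)"
    by (intro sum.cong refl sum.swap)
  also have "\<dots> = (\<Sum>i=1..n. \<Sum>j=1..n. (\<Sum>k=1..n. P i j k) * (x i * x j))"
    by (simp add: sum_distrib_right mult.assoc)
  also have "\<dots> = (\<Sum>i=1..n. \<Sum>j=1..n. x i * x j)"
    using P by (intro sum.cong) (auto simp: heredity_def)
  also have "\<dots> = (\<Sum>i=1..n. x i) * (\<Sum>j=1..n. x j)"
    by (simp add: sum_product)
  also have "\<dots> = 1" using x by (simp add: std_simplex_def)
  finally show ?thesis using nn by (auto simp: std_simplex_def) (auto simp: qso_def)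
qed

lemma qso_orbit_in_std_simplex:
  assumes "heredity n P" "x \<in> std_simplex n"
  shows "qso_orbit n P x k \<in> std_simplex n"
  by (induction k) (use assms qso_in_std_simplex in \<open>auto simp: qso_orbit_def\<close>)

lemma transition_nonneg:
  assumes "heredity n P" "x \<in> std_simplex n" "i \<in> {1..n}" "j \<in> {1..n}"
  shows "0 \<le> transition n P x k i j"
  using assms qso_orbit_in_std_simplex[OF assms(1,2), of k]
  unfolding transition_def heredity_def std_simplex_def
  by (auto intro!: sum_nonneg mult_nonneg_nonneg)

lemma transition_sum:
  assumes P: "heredity n P" and "x \<in> std_simplex n" "i \<in> {1..n}"
  shows "(\<Sum>j=1..n. transition n P x k i j) = 1"
proof -
  have "(\<Sum>j=1..n. transition n P x k i j) = (\<Sum>l=1..n. \<Sum>j=1..n. P i l j * qso_orbit n P x k l)"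
    unfolding transition_def by (rule sum.swap)
  also have "\<dots> = (\<Sum>l=1..n. (\<Sum>j=1..n. P i l j) * qso_orbit n P x k l)"
    by (simp add: sum_distrib_right)
  also have "\<dots> = (\<Sum>l=1..n. qso_orbit n P x k l)"
    using P assms(3) by (intro sum.cong) (auto simp: heredity_def)
  also have "\<dots> = 1"
    using qso_orbit_in_std_simplex[OF assms(1,2), of k] by (simp add: std_simplex_def)
  finally show ?thesis .
qed

lemma qso_orbit_Suc:
  assumes "j \<in> {1..n}"
  shows "qso_orbit n P x (Suc k) j = (\<Sum>i=1..n. qso_orbit n P x k i * transition n P x k i j)"
  using assms
  by (auto simp: qso_orbit_def qso_def transition_def sum_distrib_left intro!: sum.cong)

lemma cylinder_in_sets_PiM:
  "cylinder n l m a \<in> sets (Pi\<^sub>M UNIV (\<lambda>_. count_space {1..n}))"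
proof -
  let ?M = "Pi\<^sub>M UNIV (\<lambda>_::nat. count_space {1..n})"
  have sp: "space ?M = path_set n" by (simp add: space_PiM path_set_def PiE_def)
  have "cylinder n l m a = {\<omega> \<in> space ?M. \<forall>j\<in>{l..m}. \<omega> j = a j}"
    by (simp only: cylinder_def sp)
  also have "\<dots> \<in> sets ?M"
  proof (intro sets.sets_Collect_finite_All)
    fix j assume "j \<in> {l..m}"
    have "(\<lambda>\<omega>. \<omega> j) -` ({a j} \<inter> {1..n}) \<inter> space ?M \<in> sets ?M"
      by (rule measurable_sets[OF measurable_component_singleton]) auto
    also have "(\<lambda>\<omega>. \<omega> j) -` ({a j} \<inter> {1..n}) \<inter> space ?M = {\<omega> \<in> space ?M. \<omega> j = a j}"
      unfolding sp by (auto simp: path_set_def)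
    finally show "{\<omega> \<in> space ?M. \<omega> j = a j} \<in> sets ?M" .
  qed auto
  finally show ?thesis .
qed

lemma sets_PiM_path_algebra:
  "sets (Pi\<^sub>M UNIV (\<lambda>_. count_space {1..n})) = path_algebra n"
proof -
  let ?M = "Pi\<^sub>M UNIV (\<lambda>_::nat. count_space {1..n})"
  have sp: "space ?M = path_set n" by (simp add: space_PiM path_set_def PiE_def)
  have E: "thin_cylinders n \<subseteq> Pow (path_set n)"
    by (auto simp: thin_cylinders_def cylinder_def)
  interpret S: sigma_algebra "path_set n" "sigma_sets (path_set n) (thin_cylinders n)"
    by (rule sigma_algebra_sigma_sets[OF E])
  show ?thesis
  proof
    have "C \<in> sets ?M" if "C \<in> thin_cylinders n" for C
      using that cylinder_in_sets_PiM by (auto simp only: thin_cylinders_def)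
    then show "path_algebra n \<subseteq> sets ?M"
      unfolding path_algebra_def sp[symmetric] by (intro sets.sigma_sets_subset) auto
  next
    have "sets ?M = sigma_sets (\<Pi>\<^sub>E i\<in>UNIV. {1..n})
        {{f\<in>\<Pi>\<^sub>E i\<in>UNIV. {1..n}. f i \<in> A} | i A. i \<in> (UNIV::nat set) \<and> A \<in> Pow {1..n}}"
      by (simp add: sets_PiM_single)
    also have "\<dots> \<subseteq> path_algebra n"
      unfolding path_algebra_def PiE_UNIV_domain path_set_def[symmetric]
    proof (rule S.sigma_sets_subset, safe)
      fix i :: nat and A assume A: "A \<subseteq> {1..n}"
      have "{f \<in> path_set n. f i \<in> A} = (\<Union>j\<in>A. cylinder n i i (\<lambda>_. j))"
        by (auto simp: cylinder_def)
      also have "\<dots> \<in> sigma_sets (path_set n) (thin_cylinders n)"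
        using A finite_subset[OF A]
        by (intro S.finite_UN sigma_sets.Basic) (auto simp: thin_cylinders_def)
      finally show "{f \<in> path_set n. f i \<in> A} \<in> sigma_sets (path_set n) (thin_cylinders n)" .
    qed
    finally show "sets ?M \<subseteq> path_algebra n" .
  qed
qed

lemma cylinder_in_path_algebra: "cylinder n l m a \<in> path_algebra n"
  using cylinder_in_sets_PiM[of n l m a] by (simp only: sets_PiM_path_algebra)

lemma cylinder_cong: "(\<And>j. j \<in> {l..m} \<Longrightarrow> a j = b j) \<Longrightarrow> cylinder n l m a = cylinder n l m b"
  by (auto simp: cylinder_def)

lemma cylinder_split:
  "cylinder n (Suc l) m a = (\<Union>i\<in>{1..n}. cylinder n l m (a(l := i)))" if "Suc l \<le> m"
proof -
  have "{l..m} = insert l {Suc l..m}" using that by auto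
  then show ?thesis by (auto simp: cylinder_def path_set_def)
qed

text \<open>Cylinders starting at time 0 already generate and are closed under intersection.\<close>

lemma markov_measure_unique:
  assumes M: "is_markov_measure n P x M" and N: "is_markov_measure n P x N"
  shows "M = N"
proof -
  interpret M: prob_space M using M by (simp add: is_markov_measure_def)
  interpret N: prob_space N using N by (simp add: is_markov_measure_def)
  have spM: "space M = path_set n" and spN: "space N = path_set n"
    and sM: "sets M = path_algebra n" and sN: "sets N = path_algebra n"
    using M N by (auto simp: is_markov_measure_def)
  define E where "E = insert {} (insert (path_set n)
    {cylinder n 0 m a | m a. a \<in> {0..m} \<rightarrow> {1..n}})"
  have EP: "E \<subseteq> Pow (path_set n)" by (auto simp: E_def cylinder_def)
  interpret S: sigma_algebra "path_set n" "sigma_sets (path_set n) E"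
    by (rule sigma_algebra_sigma_sets[OF EP])
  have int0: "cylinder n 0 m a \<inter> cylinder n 0 m' b \<in> E"
    if "a \<in> {0..m} \<rightarrow> {1..n}" "b \<in> {0..m'} \<rightarrow> {1..n}" "m \<le> m'" for m m' a b
  proof (cases "\<forall>j\<in>{0..m}. a j = b j")
    case True
    then have "cylinder n 0 m a \<inter> cylinder n 0 m' b = cylinder n 0 m' b"
      using that by (auto simp: cylinder_def)
    then show ?thesis using that by (auto simp: E_def)
  next
    case False
    then obtain j where j: "j \<le> m" "a j \<noteq> b j" by auto
    have "cylinder n 0 m a \<inter> cylinder n 0 m' b = {}"
    proof (intro equals0I)
      fix \<omega> assume "\<omega> \<in> cylinder n 0 m a \<inter> cylinder n 0 m' b"
      then have "\<omega> j = a j" "\<omega> j = b j" using j that(3) by (auto simp: cylinder_def)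
      then show False using j by simp
    qed
    then show ?thesis by (simp add: E_def)
  qed
  have "Int_stable E"
  proof (rule Int_stableI)
    fix A B assume AB: "A \<in> E" "B \<in> E"
    consider "A = {} \<or> B = {}" | "A = path_set n" | "B = path_set n"
      | m a m' b where "A = cylinder n 0 m a" "B = cylinder n 0 m' b"
          "a \<in> {0..m} \<rightarrow> {1..n}" "b \<in> {0..m'} \<rightarrow> {1..n}"
      using AB unfolding E_def by blast
    then show "A \<inter> B \<in> E"
    proof cases
      case 1 then show ?thesis by (auto simp: E_def)
    next
      case 2 then have "A \<inter> B = B" using AB EP by auto
      then show ?thesis using AB by simp
    next
      case 3 then have "A \<inter> B = A" using AB EP by auto
      then show ?thesis using AB by simp
    next
      case 4
      then show ?thesis using int0[of a m b m'] int0[of b m' a m]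
        by (cases "m \<le> m'") (auto simp: Int_commute)
    qed
  qed
  have cyl: "cylinder n l m a \<in> sigma_sets (path_set n) E"
    if "l \<le> m" "a \<in> {l..m} \<rightarrow> {1..n}" for l m a
    using that
  proof (induction l arbitrary: a)
    case 0
    then show ?case by (intro sigma_sets.Basic) (auto simp: E_def)
  next
    case (Suc l)
    show ?case unfolding cylinder_split[OF Suc.prems(1)]
    proof (intro S.finite_UN Suc.IH)
      fix i assume "i \<in> {1..n}"
      show "a(l := i) \<in> {l..m} \<rightarrow> {1..n}"
      proof
        fix j assume "j \<in> {l..m}"
        then show "(a(l := i)) j \<in> {1..n}"
          using Suc.prems \<open>i \<in> {1..n}\<close> by (cases "j = l") (auto simp: Pi_iff)
      qed
    qed (use Suc in auto)
  qed
  have gen: "path_algebra n = sigma_sets (path_set n) E"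
  proof
    show "path_algebra n \<subseteq> sigma_sets (path_set n) E"
      unfolding path_algebra_def
      by (intro S.sigma_sets_subset) (auto simp: thin_cylinders_def intro!: cyl)
    have "E \<subseteq> sets M"
      using cylinder_in_path_algebra[of n 0] sets.top[of M] sets.empty_sets[of M]
      by (auto simp: E_def sM spM)
    then have "sigma_sets (space M) E \<subseteq> sets M" by (rule sets.sigma_sets_subset)
    then show "sigma_sets (path_set n) E \<subseteq> path_algebra n" by (simp add: sM spM)
  qed
  show ?thesis
  proof (rule measure_eqI_generator_eq[OF \<open>Int_stable E\<close> EP])
    fix X assume "X \<in> E"
    then have "measure M X = measure N X"
      unfolding E_def
    proof (elim insertE CollectE exE conjE)
      assume "X = path_set n"
      then show ?thesis using M.prob_space N.prob_space spM spN by simp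
    next
      fix m a assume "X = cylinder n 0 m a" "a \<in> {0..m} \<rightarrow> {1..n}"
      then show ?thesis using M N unfolding is_markov_measure_def by simp
    qed auto
    then show "emeasure M X = emeasure N X"
      by (simp add: M.emeasure_eq_measure N.emeasure_eq_measure)
  next
    show "range (\<lambda>i::nat. path_set n) \<subseteq> E" by (auto simp: E_def)
  qed (auto simp: sM sN gen)
qed

lemma markov_measure_exists:
  assumes P: "heredity n P" and x: "x \<in> std_simplex n"
  shows "\<exists>M. is_markov_measure n P x M"
proof -
  define S where "S = {1..n}"
  have [simp]: "finite S" by (simp add: S_def)
  define h :: "nat \<Rightarrow> nat \<Rightarrow> nat \<Rightarrow> real" where "h = transition n P x"
  have h0: "0 \<le> h k i j" if "i \<in> S" "j \<in> S" for k i j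
    using transition_nonneg[OF P x] that by (simp add: h_def S_def)
  have h1: "(\<Sum>j\<in>S. h k i j) = 1" if "i \<in> S" for k i
    using transition_sum[OF P x] that by (simp add: h_def S_def)
  have x0: "0 \<le> x i" if "i \<in> S" for i using x that by (auto simp: std_simplex_def S_def)
  have x1: "(\<Sum>i\<in>S. x i) = 1" using x by (simp add: std_simplex_def S_def)
  define q where "q i \<omega> = (case i of 0 \<Rightarrow> x | Suc k \<Rightarrow> h k (\<omega> k))" for i :: nat and \<omega> :: "nat \<Rightarrow> nat"
  define K where "K i \<omega> = point_measure S (\<lambda>j. ennreal (q i \<omega> j))" for i \<omega>
  let ?M = "\<lambda>_::nat. count_space S"
  have q: "(\<forall>j\<in>S. 0 \<le> q i \<omega> j) \<and> (\<Sum>j\<in>S. q i \<omega> j) = 1" if "\<omega> \<in> space (PiM {0..<i} ?M)" for i \<omega>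
    using that h0 h1 x0 x1 unfolding q_def by (auto split: nat.split simp: space_PiM PiE_iff)
  have prob_point: "prob_space (point_measure S (\<lambda>j. ennreal (f j)))"
    if "\<forall>j\<in>S. 0 \<le> f j" "(\<Sum>j\<in>S. f j) = 1" for f :: "nat \<Rightarrow> real"
    using that by (intro prob_spaceI) (simp add: space_point_measure emeasure_point_measure_finite sum_ennreal)
  have prob_K: "prob_space (K i \<omega>)" if "\<omega> \<in> space (PiM {0..<i} ?M)" for i \<omega>
    unfolding K_def using q[OF that] by (intro prob_point) auto
  have inalg: "point_measure S (\<lambda>j. ennreal (f j)) \<in> space (subprob_algebra (count_space S))"
    if "\<forall>j\<in>S. 0 \<le> f j" "(\<Sum>j\<in>S. f j) = 1" for f :: "nat \<Rightarrow> real"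
    using prob_point[OF that]
    by (simp add: space_subprob_algebra prob_space_imp_subprob_space sets_point_measure)
  have meas_K: "K i \<in> measurable (PiM {0..<i} ?M) (subprob_algebra (?M i))" for i
  proof (cases i)
    case 0
    then have "K i = (\<lambda>_. point_measure S (\<lambda>j. ennreal (x j)))" by (auto simp: K_def q_def)
    then show ?thesis using inalg[of x] x0 x1 by simp
  next
    case (Suc k)
    have "(\<lambda>\<omega>. point_measure S (\<lambda>j. ennreal (h k (\<omega> k) j)))
        \<in> measurable (PiM {0..<i} ?M) (subprob_algebra (count_space S))"
    proof (rule measurable_compose[where f="\<lambda>\<omega>. \<omega> k" and N="count_space S"])
      show "(\<lambda>\<omega>. \<omega> k) \<in> measurable (PiM {0..<i} ?M) (count_space S)"
        by (rule measurable_component_singleton) (simp add: Suc)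
      show "(\<lambda>y. point_measure S (\<lambda>j. ennreal (h k y j)))
          \<in> measurable (count_space S) (subprob_algebra (count_space S))"
        using h0 h1 inalg by (auto simp: measurable_count_space_eq1)
    qed
    then show ?thesis by (simp add: K_def[abs_def] q_def Suc)
  qed
  interpret IT: Ionescu_Tulcea K ?M
    by (rule Ionescu_Tulcea.intro[OF meas_K prob_K])
  define C where "C m = IT.C 0 m (\<lambda>_. undefined)" for m
  have spC: "space (C m) = PiE {0..<m} (\<lambda>_. S)" for m
    using IT.space_C[of "\<lambda>_. undefined" 0 m] by (simp add: C_def space_PiM)
  have setsC: "sets (C m) = sets (PiM {0..<m} ?M)" for m
    using IT.sets_C[of "\<lambda>_. undefined" 0 m] by (simp add: C_def)
  have sing: "{a} \<in> sets (PiM {0..<m} ?M)" if "a \<in> PiE {0..<m} (\<lambda>_. S)" for a m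
  proof -
    have "{a} = PiE {0..<m} (\<lambda>j. {a j})"
      using that PiE_singleton[of a "{0..<m}"] by (auto simp: PiE_def)
    then show ?thesis using that by (auto intro!: sets_PiM_I_finite)
  qed
  define F where "F m a = (\<Prod>i<m. q i a (a i))" for m and a :: "nat \<Rightarrow> nat"
  have F0: "0 \<le> F m a" if "a \<in> {0..<m} \<rightarrow> S" for m a
    unfolding F_def q_def using that x0 h0
    by (intro prod_nonneg) (auto split: nat.split simp: Pi_iff)
  have C_sing: "emeasure (C m) {restrict a {0..<m}} = ennreal (F m a)"
    if "a \<in> {0..<m} \<rightarrow> S" for a m
    using that
  proof (induction m)
    case 0
    have "{\<lambda>_. undefined} \<in> sets (PiM {0..<0} ?M)" by (rule sing) simp
    then have "emeasure (C 0) {\<lambda>_. undefined} = 1"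
      unfolding C_def IT.C.simps by (subst emeasure_return) auto
    then show ?case by (simp add: F_def restrict_def)
  next
    case (Suc m)
    let ?a = "restrict a {0..<m}" and ?b = "restrict a {0..<Suc m}"
    have aS: "a \<in> {0..<m} \<rightarrow> S" "a m \<in> S" using Suc.prems by auto
    have aE: "?a \<in> PiE {0..<m} (\<lambda>_. S)" using aS by (simp add: restrict_PiE_iff Pi_iff)
    have bE: "?b \<in> PiE {0..<Suc m} (\<lambda>_. S)" using Suc.prems by (simp only: restrict_PiE_iff Pi_iff)
    have "emeasure (C (Suc m)) {?b} = emeasure (C m \<bind> IT.eP m) {?b}"
      by (simp add: C_def)
    also have "\<dots> = (\<integral>\<^sup>+\<omega>. emeasure (IT.eP m \<omega>) {?b} \<partial>C m)"
    proof (rule emeasure_bind[where N="PiM {0..<Suc m} ?M"])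
      show "space (C m) \<noteq> {}" using aE unfolding spC by blast
      show "IT.eP m \<in> measurable (C m) (subprob_algebra (PiM {0..<Suc m} ?M))"
        using IT.measurable_eP[of m] by (simp add: measurable_cong_sets[OF setsC refl])
      show "{?b} \<in> sets (PiM {0..<Suc m} ?M)" by (rule sing[OF bE])
    qed
    also have "\<dots> = (\<integral>\<^sup>+\<omega>. ennreal (q m a (a m)) * indicator {?a} \<omega> \<partial>C m)"
    proof (rule nn_integral_cong)
      fix \<omega> assume w: "\<omega> \<in> space (C m)"
      then have wE: "\<omega> \<in> PiE {0..<m} (\<lambda>_. S)" by (simp add: spC)
      have ws: "\<omega> \<in> space (PiM {0..<m} ?M)" using wE by (simp add: space_PiM)
      have e: "emeasure (IT.eP m \<omega>) {?b} = emeasure (K m \<omega>) ((\<lambda>y. fun_upd \<omega> m y) -` {?b} \<inter> S)"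
        using IT.emeasure_eP[OF ws sing[OF bE]] by simp
      show "emeasure (IT.eP m \<omega>) {?b} = ennreal (q m a (a m)) * indicator {?a} \<omega>"
      proof (cases "\<omega> = ?a")
        case True
        have "fun_upd \<omega> m y = ?b \<longleftrightarrow> y = a m" for y
        proof
          assume "fun_upd \<omega> m y = ?b"
          from fun_cong[OF this, of m] show "y = a m" by simp
        qed (auto simp: True restrict_def fun_eq_iff)
        then have pre: "(\<lambda>y. fun_upd \<omega> m y) -` {?b} \<inter> S = {a m}" using aS by auto
        have qq: "q m \<omega> (a m) = q m a (a m)"
          by (auto simp: q_def True split: nat.split)
        have "emeasure (IT.eP m \<omega>) {?b} = ennreal (q m \<omega> (a m))"
          unfolding e pre using aS by (simp add: K_def emeasure_point_measure_finite)
        also have "\<dots> = ennreal (q m a (a m)) * indicator {?a} \<omega>"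
          unfolding qq by (simp add: True)
        finally show ?thesis .
      next
        case False
        have "fun_upd \<omega> m y \<noteq> ?b" for y
        proof
          assume *: "fun_upd \<omega> m y = ?b"
          have "\<omega> i = ?a i" for i
          proof (cases "i < m")
            case True
            then show ?thesis using fun_cong[OF *, of i] by auto
          next
            case False
            then show ?thesis using wE by (auto simp: PiE_def extensional_def)
          qed
          with False show False by auto
        qed
        then have "(\<lambda>y. fun_upd \<omega> m y) -` {?b} \<inter> S = {}" by auto
        then show ?thesis using False unfolding e by simp
      qed
    qed
    also have "\<dots> = ennreal (q m a (a m)) * emeasure (C m) {?a}"
      using sing[OF aE] by (simp add: nn_integral_cmult_indicator setsC)
    also have "\<dots> = ennreal (q m a (a m)) * ennreal (F m a)"
      by (simp only: Suc.IH[OF aS(1)])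
    also have "\<dots> = ennreal (F (Suc m) a)"
      using F0[OF aS(1)] by (simp add: ennreal_mult'' F_def mult.commute)
    finally show ?case .
  qed
  define M where "M = IT.PF.lim"
  have sp: "space M = path_set n"
    unfolding M_def IT.PF.space_lim space_PiM path_set_def by (simp add: PiE_UNIV_domain S_def)
  have st: "sets M = path_algebra n"
    unfolding M_def IT.PF.sets_lim by (rule sets_PiM_path_algebra[of n, folded S_def])
  have emb: "emeasure M (cylinder n 0 m a) = ennreal (F (Suc m) a)" if a: "a \<in> {0..m} \<rightarrow> S" for m a
  proof -
    let ?J = "{0..<Suc m}" and ?a = "restrict a {0..<Suc m}"
    have aJ: "a \<in> ?J \<rightarrow> S" using a by auto
    then have aE: "?a \<in> PiE ?J (\<lambda>_. S)" by (simp only: restrict_PiE_iff Pi_iff)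
    have "cylinder n 0 m a = IT.PF.emb UNIV ?J {?a}"
    proof (intro set_eqI iffI)
      fix \<omega> assume "\<omega> \<in> cylinder n 0 m a"
      then show "\<omega> \<in> IT.PF.emb UNIV ?J {?a}"
        by (auto simp: cylinder_def path_set_def prod_emb_def S_def restrict_def fun_eq_iff PiE_def)
    next
      fix \<omega> assume w: "\<omega> \<in> IT.PF.emb UNIV ?J {?a}"
      have "\<omega> j = a j" if "j \<le> m" for j
      proof -
        have "restrict \<omega> ?J j = ?a j" using w by (simp add: prod_emb_def)
        then show ?thesis using that by simp
      qed
      then show "\<omega> \<in> cylinder n 0 m a"
        using w by (auto simp: cylinder_def path_set_def prod_emb_def S_def PiE_def)
    qed
    then have "emeasure M (cylinder n 0 m a) = emeasure (IT.CI ?J) {?a}"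
      unfolding M_def using IT.lim[OF _ sing[OF aE]] by simp
    also have "\<dots> = emeasure (C (Suc m)) (IT.PF.emb ?J ?J {?a})"
      unfolding C_def by (rule IT.emeasure_CI[OF subset_refl sing[OF aE]])
    also have "IT.PF.emb ?J ?J {?a} = {?a}"
      using aE by (subst prod_emb_id) auto
    finally show ?thesis by (simp only: C_sing[OF aJ])
  qed
  have "prob_space M"
  proof (rule prob_spaceI)
    have "emeasure M (space M) = emeasure (IT.PF.lim) (IT.PF.emb UNIV {} (space (PiM {} ?M)))"
      unfolding M_def IT.PF.space_lim
      by (rule arg_cong[where f="emeasure _"]) (auto simp: space_PiM prod_emb_def)
    also have "\<dots> = emeasure (IT.CI {}) (space (PiM {} ?M))"
      by (rule IT.lim) (rule finite.emptyI, rule sets.top)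
    also have "\<dots> = 1"
      using prob_space.emeasure_space_1[OF IT.PF.prob_space_P[of "{}"]] by (simp add: IT.PF.space_P)
    finally show "emeasure M (space M) = 1" .
  qed
  then interpret M: prob_space M .
  have F_Suc: "F (Suc m) a = x (a 0) * (\<Prod>j\<in>{0..<m}. h j (a j) (a (Suc j)))" for m a
    unfolding F_def
    by (subst prod.lessThan_Suc_shift) (simp add: q_def atLeast0LessThan)
  have formula: "measure M (cylinder n k m a) =
      qso_orbit n P x k (a k) * (\<Prod>j\<in>{k..<m}. h j (a j) (a (Suc j)))"
    if "k \<le> m" "a \<in> {k..m} \<rightarrow> {1..n}" for k m a
    using that
  proof (induction k arbitrary: a)
    case 0
    then have "a \<in> {0..m} \<rightarrow> S" by (simp add: S_def)
    moreover from this have "0 \<le> F (Suc m) a" by (intro F0) auto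
    ultimately have "measure M (cylinder n 0 m a) = F (Suc m) a"
      using emb by (simp add: measure_def)
    then show ?case by (simp add: F_Suc qso_orbit_def)
  next
    case (Suc k)
    have up: "a(k := i) \<in> {k..m} \<rightarrow> {1..n}" if "i \<in> {1..n}" for i
    proof
      fix j assume "j \<in> {k..m}"
      then show "(a(k := i)) j \<in> {1..n}"
        using Suc.prems that by (cases "j = k") (auto simp: Pi_iff)
    qed
    have aS: "a (Suc k) \<in> {1..n}" using Suc.prems by (auto simp: Pi_iff)
    have "measure M (cylinder n (Suc k) m a) = (\<Sum>i=1..n. measure M (cylinder n k m (a(k := i))))"
      unfolding cylinder_split[OF Suc.prems(1)]
    proof (rule M.finite_measure_finite_Union)
      show "disjoint_family_on (\<lambda>i. cylinder n k m (a(k := i))) {1..n}"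
        unfolding disjoint_family_on_def
      proof (intro ballI impI equals0I)
        fix i i' \<omega> assume "i \<noteq> i'"
          and w: "\<omega> \<in> cylinder n k m (a(k := i)) \<inter> cylinder n k m (a(k := i'))"
        from w Suc.prems(1) have "\<omega> k = i" "\<omega> k = i'"
          by (auto simp: cylinder_def dest!: bspec[where x=k])
        with \<open>i \<noteq> i'\<close> show False by simp
      qed
    qed (auto simp: st cylinder_in_path_algebra)
    also have "\<dots> = (\<Sum>i=1..n. qso_orbit n P x k i * h k i (a (Suc k)) *
        (\<Prod>j\<in>{Suc k..<m}. h j (a j) (a (Suc j))))"
    proof (rule sum.cong[OF refl])
      fix i assume i: "i \<in> {1..n}"
      have iv: "{k..<m} = insert k {Suc k..<m}" using Suc.prems(1) by auto
      have "measure M (cylinder n k m (a(k := i))) = qso_orbit n P x k i *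
          (\<Prod>j\<in>{k..<m}. h j ((a(k := i)) j) ((a(k := i)) (Suc j)))"
        by (subst Suc.IH[OF _ up[OF i]]) (use Suc.prems(1) in auto)
      also have "(\<Prod>j\<in>{k..<m}. h j ((a(k := i)) j) ((a(k := i)) (Suc j))) =
          h k i (a (Suc k)) * (\<Prod>j\<in>{Suc k..<m}. h j ((a(k := i)) j) ((a(k := i)) (Suc j)))"
        unfolding iv by (subst prod.insert) auto
      also have "(\<Prod>j\<in>{Suc k..<m}. h j ((a(k := i)) j) ((a(k := i)) (Suc j))) =
          (\<Prod>j\<in>{Suc k..<m}. h j (a j) (a (Suc j)))"
        by (intro prod.cong) auto
      finally show "measure M (cylinder n k m (a(k := i))) = qso_orbit n P x k i *
          h k i (a (Suc k)) * (\<Prod>j\<in>{Suc k..<m}. h j (a j) (a (Suc j)))"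
        by (simp only: mult.assoc)
    qed
    also have "\<dots> = qso_orbit n P x (Suc k) (a (Suc k)) *
        (\<Prod>j\<in>{Suc k..<m}. h j (a j) (a (Suc j)))"
      unfolding qso_orbit_Suc[OF aS] h_def by (simp add: sum_distrib_right)
    finally show ?case .
  qed
  have "is_markov_measure n P x M"
    unfolding is_markov_measure_def
    using M.prob_space_axioms sp st formula by (simp add: h_def)
  then show ?thesis ..
qed

lemma is_markov_measure_markov_measure:
  assumes "heredity n P" "x \<in> std_simplex n"
  shows "is_markov_measure n P x (markov_measure n P x)"
proof -
  obtain M where M: "is_markov_measure n P x M"
    using markov_measure_exists[OF assms] by (rule exE)
  show ?thesis
    unfolding markov_measure_def by (rule theI[where P="is_markov_measure n P x", OF M]) (rule markov_measure_unique[OF _ M])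
qed

end

theory Submission
  imports Defs
begin

text \<open>
  Along the orbit of a \<open>b\<close>-bistochastic operator the partial sums of the coordinates decrease,
  so the orbit converges; its limit is a fixed point and hence the last vertex. Thus the event
  \<open>D\<^sub>m = {\<omega>. \<omega>\<^sub>m = n}\<close> has probability tending to 1. By the Markov property, on \<open>D\<^sub>m\<close> the future
  \<open>\<sigma>\<^sup>-\<^sup>m(B)\<close> is independent of every event \<open>A\<close> determined before time \<open>m\<close>, so the correlation of
  \<open>A\<close> and \<open>\<sigma>\<^sup>-\<^sup>m(B)\<close> is at most \<open>4 (1 - \<mu>(D\<^sub>m))\<close>. A Dynkin argument extends this to all \<open>A\<close>.
\<close>

section \<open>Convergence of the orbit to the last vertex\<close>

text \<open>The order \<open>b_le\<close> controls only initial partial sums; differences of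
  consecutive ones give back the single coordinates.\<close>

lemma tendsto_of_partial_sums:
  fixes f :: "nat \<Rightarrow> nat \<Rightarrow> real"
  assumes "\<And>j. j \<le> n \<Longrightarrow> (\<lambda>k. \<Sum>i=1..j. f k i) \<longlonglongrightarrow> s j" and "i \<in> {1..n}"
  shows "(\<lambda>k. f k i) \<longlonglongrightarrow> s i - s (i - 1)"
proof -
  have "(\<lambda>k. (\<Sum>i=1..i. f k i) - (\<Sum>i=1..i-1. f k i)) \<longlonglongrightarrow> s i - s (i - 1)"
    using assms(2) by (intro tendsto_diff assms(1)) auto
  moreover have "(\<Sum>i=1..i. f k i) - (\<Sum>i=1..i-1. f k i) = f k i" for k
    using assms(2) by (cases i) auto
  ultimately show ?thesis by simp
qed

lemma qso_orbit_tendsto_last_vertex: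
  assumes P: "heredity n P" and b: "b_bistochastic n (qso n P)"
    and fix_P: "{y \<in> std_simplex n. qso n P y = y} = {last_vertex n}"
    and x: "x \<in> std_simplex n" and i: "i \<in> {1..n}"
  shows "(\<lambda>k. qso_orbit n P x k i) \<longlonglongrightarrow> last_vertex n i"
proof -
  let ?f = "qso_orbit n P x"
  have simplex: "?f k \<in> std_simplex n" for k
    by (rule qso_orbit_in_std_simplex[OF P x])
  have nonneg: "0 \<le> ?f k i" for k i
    using simplex[of k] by (cases "i \<in> {1..n}") (auto simp: std_simplex_def)
  have total: "(\<Sum>i=1..n. ?f k i) = 1" for k
    using simplex[of k] by (auto simp: std_simplex_def)
  have step: "?f (Suc k) = qso n P (?f k)" for k
    by (simp add: qso_orbit_def)
  have "convergent (\<lambda>k. \<Sum>i=1..j. ?f k i)" if "j \<le> n" for j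
  proof -
    \<comment> \<open>\<open>b_le\<close> compares only the sums up to indices in
      \<open>{1..n-1}\<close>. The two remaining sums are constant along the orbit: the empty one is
      0 and the full one is 1.\<close>
    have "j = 0 \<or> j = n \<or> j \<in> {1..n-1}" using that by auto
    then consider "j = 0" | "j = n" | "j \<in> {1..n-1}" by blast
    then show ?thesis
    proof cases
      case 3
      have "decseq (\<lambda>k. \<Sum>i=1..j. ?f k i)"
      proof (rule decseq_SucI)
        fix k
        show "(\<Sum>i=1..j. ?f (Suc k) i) \<le> (\<Sum>i=1..j. ?f k i)"
          using b simplex[of k] 3 unfolding b_bistochastic_def b_le_def step by blast
      qed
      then obtain L where "(\<lambda>k. \<Sum>i=1..j. ?f k i) \<longlonglongrightarrow> L"
        by (rule decseq_convergent[where B=0]) (auto intro: sum_nonneg nonneg)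
      then show ?thesis by (auto simp: convergent_def)
    next
      case 2
      show ?thesis unfolding 2 total by (rule convergent_const)
    qed (simp add: convergent_const)
  qed
  then have "\<forall>j. \<exists>s. j \<le> n \<longrightarrow> (\<lambda>k. \<Sum>i=1..j. ?f k i) \<longlonglongrightarrow> s"
    by (auto simp: convergent_def)
  then obtain s where s: "\<And>j. j \<le> n \<Longrightarrow> (\<lambda>k. \<Sum>i=1..j. ?f k i) \<longlonglongrightarrow> s j"
    by metis
  \<comment> \<open>The value 0 outside \<open>{1..n}\<close> puts \<open>z\<close> into
    \<open>std_simplex n\<close>, whose points are compared as functions; this is what lets the
    uniqueness of the fixed point apply.\<close>
  define z where "z i = (if i \<in> {1..n} then s i - s (i - 1) else 0)" for i
  have z: "(\<lambda>k. ?f k i) \<longlonglongrightarrow> z i" if "i \<in> {1..n}" for i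
    using tendsto_of_partial_sums[of n ?f s i] s that by (simp add: z_def)
  have "0 \<le> z i" for i
  proof (cases "i \<in> {1..n}")
    case True
    then show ?thesis by (intro LIMSEQ_le_const[OF z]) (auto simp: nonneg)
  qed (auto simp: z_def)
  moreover have "(\<Sum>i=1..n. z i) = 1"
  proof (rule LIMSEQ_unique)
    show "(\<lambda>k. \<Sum>i=1..n. ?f k i) \<longlonglongrightarrow> (\<Sum>i=1..n. z i)" by (intro tendsto_sum z)
    show "(\<lambda>k. \<Sum>i=1..n. ?f k i) \<longlonglongrightarrow> 1" unfolding total by (rule tendsto_const)
  qed
  ultimately have z_simplex: "z \<in> std_simplex n"
    unfolding std_simplex_def by (auto simp del: One_nat_def) (auto simp: z_def)
  have "qso n P z = z"
  proof
    fix j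
    show "qso n P z j = z j"
    proof (cases "j \<in> {1..n}")
      case True
      \<comment> \<open>Each coordinate of the operator is a polynomial in finitely many
        coordinates, hence continuous. The same sequence is the orbit moved by one time step, so it
        also tends to \<open>z j\<close>.\<close>
      have "(\<lambda>k. qso n P (?f k) j) \<longlonglongrightarrow> qso n P z j"
        using True by (simp add: qso_def) (intro tendsto_intros z, auto)
      moreover have "(\<lambda>k. qso n P (?f k) j) \<longlonglongrightarrow> z j"
        using LIMSEQ_Suc[OF z[OF True]] by (simp add: step)
      ultimately show ?thesis by (rule LIMSEQ_unique)
    qed (auto simp: qso_def z_def)
  qed
  with z_simplex fix_P have "z = last_vertex n" by blast
  with z[OF i] show ?thesis by simp
qed

section \<open>Cylinders and induction over the path algebra\<close>

lemma cylinder_Suc: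
  "cylinder n 0 l a = (\<Union>i\<in>{1..n}. cylinder n 0 (Suc l) (a(Suc l := i)))"
  by (auto simp: cylinder_def path_set_def atLeastAtMostSuc_conv)

lemma cylinder_fun_upd_disjoint:
  assumes "k \<in> {l..m}"
  shows "disjoint_family_on (\<lambda>i. cylinder n l m (a(k := i))) I"
  using assms by (auto simp: disjoint_family_on_def cylinder_def dest!: bspec[where x=k])

text \<open>Dynkin's theorem for cylinders that start at time 0. Two of these are either disjoint or
  nested, so together with the empty set they are stable under intersection, whereas thin cylinders
  over separated time intervals in general do not meet in a thin cylinder.\<close>

lemma path_algebra_induct [consumes 1, case_names cylinder empty compl union]:
  assumes "A \<in> path_algebra n"
    and cylinder: "\<And>m a. a \<in> {0..m} \<rightarrow> {1..n} \<Longrightarrow> Q (cylinder n 0 m a)"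
    and empty: "Q {}"
    and compl: "\<And>A. A \<in> path_algebra n \<Longrightarrow> Q A \<Longrightarrow> Q (path_set n - A)"
    and union: "\<And>A. disjoint_family A \<Longrightarrow> range A \<subseteq> path_algebra n \<Longrightarrow>
      (\<And>i. Q (A i)) \<Longrightarrow> Q (\<Union>i::nat. A i)"
  shows "Q A"
proof -
  define E where "E = insert {} {cylinder n 0 m a | m a. a \<in> {0..m} \<rightarrow> {1..n}}"
  have E_Pow: "E \<subseteq> Pow (path_set n)" by (auto simp: E_def cylinder_def)
  interpret S: sigma_algebra "path_set n" "sigma_sets (path_set n) E"
    by (rule sigma_algebra_sigma_sets[OF E_Pow])
  \<comment> \<open>The starting time is lowered to 0 step by step: a cylinder from time
    \<open>Suc l\<close> on is a finite union of cylinders from time \<open>l\<close> on, one for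
    each state at time \<open>l\<close>.\<close>
  have cyl: "cylinder n l m a \<in> sigma_sets (path_set n) E"
    if "l \<le> m" "a \<in> {l..m} \<rightarrow> {1..n}" for l m a
    using that
  proof (induction l arbitrary: a)
    case 0
    then show ?case by (intro sigma_sets.Basic) (auto simp: E_def)
  next
    case (Suc l)
    show ?case unfolding cylinder_split[OF Suc.prems(1)]
    proof (intro S.finite_UN Suc.IH)
      fix i assume "i \<in> {1..n}"
      then show "a(l := i) \<in> {l..m} \<rightarrow> {1..n}"
        using Suc.prems by (auto simp: Pi_iff)
    qed (use Suc.prems in auto)
  qed
  have sub: "path_algebra n \<subseteq> sigma_sets (path_set n) E"
    unfolding path_algebra_def using cyl
    by (intro S.sigma_sets_subset) (auto simp: thin_cylinders_def)
  have "E \<subseteq> path_algebra n"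
    using cylinder_in_path_algebra by (auto simp: E_def path_algebra_def intro: sigma_sets.Empty)
  \<comment> \<open>For the inclusion from left to right, the path algebra is read as the product
    sigma-algebra of discrete spaces, which is closed under the sigma-algebra operations.\<close>
  then have eq: "sigma_sets (path_set n) E = path_algebra n"
    using sub sets.sigma_sets_subset[of E "Pi\<^sub>M UNIV (\<lambda>_. count_space {1..n})"]
    unfolding sets_PiM_path_algebra by (auto simp: space_PiM path_set_def PiE_UNIV_domain)
  have Int: "cylinder n 0 m a \<inter> cylinder n 0 m' b \<in> E"
    if "a \<in> {0..m} \<rightarrow> {1..n}" "b \<in> {0..m'} \<rightarrow> {1..n}" "m \<le> m'" for m m' a b
  proof (cases "\<forall>j\<in>{0..m}. a j = b j")
    case True
    then have "cylinder n 0 m a \<inter> cylinder n 0 m' b = cylinder n 0 m' b"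
      using that by (auto simp: cylinder_def)
    then show ?thesis using that by (auto simp: E_def)
  next
    case False
    then have "cylinder n 0 m a \<inter> cylinder n 0 m' b = {}"
      using that(3) by (fastforce simp: cylinder_def)
    then show ?thesis by (simp add: E_def)
  qed
  have "Int_stable E"
  proof (rule Int_stableI)
    fix A B assume AB: "A \<in> E" "B \<in> E"
    then consider "A \<inter> B = {}" | m a m' b where "A = cylinder n 0 m a" "B = cylinder n 0 m' b"
        "a \<in> {0..m} \<rightarrow> {1..n}" "b \<in> {0..m'} \<rightarrow> {1..n}"
      unfolding E_def by blast
    then show "A \<inter> B \<in> E"
    proof cases
      case 2
      then show ?thesis using Int[of a m b m'] Int[of b m' a m]
        by (cases "m \<le> m'") (auto simp: Int_commute)
    qed (simp add: E_def)
  qed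
  from this E_Pow assms(1)[folded eq] show ?thesis
  proof (induction rule: sigma_sets_induct_disjoint)
    case (basic A)
    then show ?case using cylinder empty by (auto simp: E_def)
  qed (use empty compl union eq in auto)
qed

section \<open>Preimages under powers of the shift\<close>

lemma shift_funpow: "(shift ^^ m) \<omega> = (\<lambda>k. \<omega> (m + k))"
  by (induction m arbitrary: \<omega>) (auto simp: shift_def funpow_Suc_right simp del: funpow.simps)

lemma shift_preimage_cylinder:
  "shift_preimage n m (cylinder n 0 r b) = cylinder n m (m + r) (\<lambda>j. b (j - m))"
proof -
  have "(\<forall>j\<in>{0..r}. \<omega> (m + j) = b j) \<longleftrightarrow> (\<forall>j\<in>{m..m+r}. \<omega> j = b (j - m))" for \<omega>
  proof
    assume *: "\<forall>j\<in>{0..r}. \<omega> (m + j) = b j"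
    show "\<forall>j\<in>{m..m+r}. \<omega> j = b (j - m)"
    proof
      fix j assume "j \<in> {m..m+r}"
      then show "\<omega> j = b (j - m)" using *[rule_format, of "j - m"] by auto
    qed
  qed auto
  then show ?thesis
    by (auto simp: shift_preimage_def cylinder_def shift_funpow path_set_def)
qed

lemma shift_preimage_compl:
  "shift_preimage n m (path_set n - B) = path_set n - shift_preimage n m B"
proof -
  have "(shift ^^ m) \<omega> \<in> path_set n" if "\<omega> \<in> path_set n" for \<omega>
    using that unfolding shift_funpow path_set_def by blast
  then show ?thesis by (auto simp: shift_preimage_def)
qed

lemma shift_preimage_UN: "shift_preimage n m (\<Union>i\<in>I. B i) = (\<Union>i\<in>I. shift_preimage n m (B i))"
  by (auto simp: shift_preimage_def)

lemma shift_preimage_in_path_algebra: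
  assumes "B \<in> path_algebra n"
  shows "shift_preimage n m B \<in> path_algebra n"
  using assms
proof (induction rule: path_algebra_induct)
  case (cylinder r b)
  then show ?case by (simp add: shift_preimage_cylinder cylinder_in_path_algebra)
next
  case empty
  then show ?case by (simp add: shift_preimage_def path_algebra_def sigma_sets.Empty)
next
  case (compl B)
  then show ?case by (simp add: shift_preimage_compl path_algebra_def sigma_sets.Compl)
next
  case (union B)
  then show ?case by (simp add: shift_preimage_UN path_algebra_def sigma_sets.Union)
qed

section \<open>The Markov property\<close>

text \<open>Conditional independence of past and future given the state at time \<open>m\<close>,
  cross-multiplied because \<open>measure M D\<close> may vanish. Both sides are countably additive
  in \<open>B\<close>, so cylinders decide; for them the product of transition probabilities splits
  at time \<open>m\<close>.\<close>

lemma markov_property_full_past: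
  assumes M: "is_markov_measure n P x M"
    and a: "a \<in> {0..m} \<rightarrow> {1..n}" and B: "B \<in> path_algebra n"
  defines "D \<equiv> cylinder n m m a"
  shows "measure M (cylinder n 0 m a \<inter> shift_preimage n m B) * measure M D =
    measure M (cylinder n 0 m a) * measure M (D \<inter> shift_preimage n m B)"
  using B
proof (induction rule: path_algebra_induct)
  case (cylinder r b)
  show ?case
  \<comment> \<open>Past and shifted future both prescribe the state at time \<open>m\<close>. If
    they disagree, both sides are 0; otherwise they glue to one path \<open>c\<close>.\<close>
  proof (cases "b 0 = a m")
    case False
    then have "cylinder n 0 m a \<inter> shift_preimage n m (cylinder n 0 r b) = {}"
      "D \<inter> shift_preimage n m (cylinder n 0 r b) = {}"
      unfolding shift_preimage_cylinder D_def by (auto simp: cylinder_def dest!: bspec[where x=m])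
    then show ?thesis by simp
  next
    case True
    define c where "c j = (if j \<le> m then a j else b (j - m))" for j
    have b_eq: "b (j - m) = c j" if "m \<le> j" for j
      using that True by (cases "j = m") (auto simp: c_def)
    have c: "c \<in> {0..m+r} \<rightarrow> {1..n}" using a cylinder by (auto simp: c_def Pi_iff)
    have S: "shift_preimage n m (cylinder n 0 r b) = cylinder n m (m+r) c"
      unfolding shift_preimage_cylinder by (rule cylinder_cong) (auto simp: b_eq)
    have A: "cylinder n 0 m a = cylinder n 0 m c" and D: "D = cylinder n m m c"
      unfolding D_def by (auto intro!: cylinder_cong simp: c_def)
    have "cylinder n 0 m a \<inter> shift_preimage n m (cylinder n 0 r b) = cylinder n 0 (m+r) c"
    proof -
      have "{0..m+r} = {0..m} \<union> {m..m+r}" by auto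
      then show ?thesis unfolding A S by (auto simp: cylinder_def)
    qed
    moreover have "D \<inter> shift_preimage n m (cylinder n 0 r b) = cylinder n m (m+r) c"
      unfolding D S by (auto simp: cylinder_def)
    moreover have "measure M (cylinder n k l c) =
        qso_orbit n P x k (c k) * (\<Prod>j\<in>{k..<l}. transition n P x j (c j) (c (Suc j)))"
      if "k \<le> l" "l \<le> m + r" for k l
    proof -
      have "c \<in> {k..l} \<rightarrow> {1..n}" using c that by auto
      with M that show ?thesis unfolding is_markov_measure_def by blast
    qed
    moreover have "{0..<m+r} = {0..<m} \<union> {m..<m+r}" by auto
    ultimately show ?thesis
      unfolding A D by (simp add: prod.union_disjoint)
  qed
next
  case empty
  then show ?case by (simp add: shift_preimage_def)
next
  case (compl B)
  interpret prob_space M using M by (simp add: is_markov_measure_def)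
  have sets: "sets M = path_algebra n" and sp: "space M = path_set n"
    using M by (auto simp: is_markov_measure_def)
  have "measure M (C \<inter> shift_preimage n m (path_set n - B)) =
      measure M C - measure M (C \<inter> shift_preimage n m B)" if "C \<in> sets M" for C
  proof -
    have "C \<inter> shift_preimage n m (path_set n - B) = C - (C \<inter> shift_preimage n m B)"
      using sets.sets_into_space[OF that] by (auto simp: shift_preimage_compl sp)
    then show ?thesis
      using that shift_preimage_in_path_algebra[OF compl(1), of m, folded sets]
      by (simp add: finite_measure_Diff)
  qed
  note diff = this
  have "cylinder n 0 m a \<in> sets M" "D \<in> sets M"
    by (auto simp: sets D_def cylinder_in_path_algebra)
  from this[THEN diff] show ?case
    using compl(2) by (simp only: left_diff_distrib right_diff_distrib mult.commute)
next
  case (union B)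
  interpret prob_space M using M by (simp add: is_markov_measure_def)
  have sets: "sets M = path_algebra n"
    using M by (auto simp: is_markov_measure_def)
  have sums: "(\<lambda>i. measure M (C \<inter> shift_preimage n m (B i))) sums
      measure M (C \<inter> shift_preimage n m (\<Union>i. B i))" if "C \<in> sets M" for C
    unfolding shift_preimage_UN Int_UN_distrib
  proof (rule finite_measure_UNION)
    have "shift_preimage n m (B i) \<in> sets M" for i
      unfolding sets using union(2) by (intro shift_preimage_in_path_algebra) auto
    then show "range (\<lambda>i. C \<inter> shift_preimage n m (B i)) \<subseteq> sets M"
      using that by auto
    show "disjoint_family (\<lambda>i. C \<inter> shift_preimage n m (B i))"
      using union(1) by (auto simp: disjoint_family_on_def shift_preimage_def)
  qed
  have "cylinder n 0 m a \<in> sets M" "D \<in> sets M"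
    by (auto simp: sets D_def cylinder_in_path_algebra)
  \<comment> \<open>Both sides of the claim are sums of series whose terms agree by the induction
    hypothesis.\<close>
  note * = sums_mult2[OF sums[OF this(1)], of "measure M D"]
    sums_mult[OF sums[OF this(2)], of "measure M (cylinder n 0 m a)"]
  show ?case
    using * union(3) by (auto intro: sums_unique2)
qed

text \<open>Downward induction on \<open>l\<close> from \<open>m\<close>: a past known up to time
  \<open>l\<close> is the disjoint union of its extensions to time \<open>Suc l\<close>, and both
  sides are additive in the past. At \<open>l = m\<close> the past fixes the state at time
  \<open>m\<close>, so it either lies inside \<open>D\<close> or misses it.\<close>

lemma markov_property:
  fixes i :: nat
  assumes M: "is_markov_measure n P x M"
    and a: "a \<in> {0..l} \<rightarrow> {1..n}" and "l \<le> m" and B: "B \<in> path_algebra n"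
  defines "D \<equiv> cylinder n m m (\<lambda>_. i)"
  shows "measure M (cylinder n 0 l a \<inter> D \<inter> shift_preimage n m B) * measure M D =
    measure M (cylinder n 0 l a \<inter> D) * measure M (D \<inter> shift_preimage n m B)"
  using \<open>l \<le> m\<close> a
proof (induction arbitrary: a rule: inc_induct)
  case base
  show ?case
  proof (cases "a m = i")
    case True
    then have "D = cylinder n m m a" unfolding D_def by (intro cylinder_cong) auto
    moreover from this have "cylinder n 0 m a \<inter> D = cylinder n 0 m a"
      by (auto simp: cylinder_def)
    ultimately show ?thesis
      using markov_property_full_past[OF M base B] by simp
  next
    case False
    then have "cylinder n 0 m a \<inter> D = {}" by (auto simp: D_def cylinder_def)
    then show ?thesis by simp
  qed
next
  case (step l)
  interpret prob_space M using M by (simp add: is_markov_measure_def)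
  have sets: "sets M = path_algebra n" using M by (auto simp: is_markov_measure_def)
  define A where "A j = cylinder n 0 (Suc l) (a(Suc l := j))" for j
  have split: "measure M (cylinder n 0 l a \<inter> C) = (\<Sum>j=1..n. measure M (A j \<inter> C))"
    if "C \<in> sets M" for C
    unfolding cylinder_Suc[of n l] A_def UN_simps(4)[symmetric]
  proof (rule finite_measure_finite_Union)
    show "disjoint_family_on (\<lambda>j. cylinder n 0 (Suc l) (a(Suc l := j)) \<inter> C) {1..n}"
      using cylinder_fun_upd_disjoint[of "Suc l" 0 "Suc l" n a "{1..n}"]
      by (auto simp: disjoint_family_on_def)
    show "(\<lambda>j. cylinder n 0 (Suc l) (a(Suc l := j)) \<inter> C) ` {1..n} \<subseteq> events"
      using that cylinder_in_path_algebra[of n, folded sets] by blast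
  qed simp
  have D: "D \<in> sets M" and S: "shift_preimage n m B \<in> sets M"
    using B by (auto simp: D_def sets cylinder_in_path_algebra shift_preimage_in_path_algebra)
  have "measure M (A j \<inter> D \<inter> shift_preimage n m B) * measure M D =
      measure M (A j \<inter> D) * measure M (D \<inter> shift_preimage n m B)" if "j \<in> {1..n}" for j
    unfolding A_def using step.prems that by (intro step.IH) (auto simp: Pi_iff)
  then show ?case
    using D S by (simp add: split Int_assoc sum_distrib_right)
qed

section \<open>Decay of correlations\<close>

text \<open>Intersecting an event with \<open>D\<close> lowers its probability by at most
  \<open>1 - prob D\<close>. Hence each of two products of probabilities moves by at most twice this
  amount, and by \<open>indep\<close> the two altered products coincide.\<close>

lemma (in prob_space) correlation_le:
  assumes A: "A \<in> events" and D: "D \<in> events" and S: "S \<in> events"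
    and indep: "prob (A \<inter> D \<inter> S) * prob D = prob (A \<inter> D) * prob (D \<inter> S)"
  shows "\<bar>prob (A \<inter> S) - prob A * prob S\<bar> \<le> 4 * (1 - prob D)"
proof -
  let ?e = "1 - prob D"
  have near: "prob C - ?e \<le> prob (C \<inter> D)" "prob (C \<inter> D) \<le> prob C" if "C \<in> events" for C
  proof -
    have "prob C = prob (C \<inter> D) + prob (C - D)"
      using that D by (subst finite_measure_Union[symmetric]) (auto intro: arg_cong[where f=prob])
    moreover have "prob (C - D) \<le> prob (space M - D)"
      using that D sets.sets_into_space by (intro finite_measure_mono) auto
    ultimately show "prob C - ?e \<le> prob (C \<inter> D)" "prob (C \<inter> D) \<le> prob C"
      using prob_compl[OF D] by auto
  qed
  have mult: "\<bar>p * q - p' * q'\<bar> \<le> 2 * ?e"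
    if "p - ?e \<le> p'" "p' \<le> p" "q - ?e \<le> q'" "q' \<le> q" "0 \<le> p'" "p \<le> 1" "0 \<le> q'" "q \<le> 1"
    for p q p' q' :: real
  proof -
    have "p * q - p' * q' = (p - p') * q + p' * (q - q')" by (simp add: algebra_simps)
    moreover have "(p - p') * q \<le> ?e * 1" using that by (intro mult_mono) auto
    moreover have "p' * (q - q') \<le> 1 * ?e" using that by (intro mult_mono) auto
    moreover have "0 \<le> (p - p') * q" "0 \<le> p' * (q - q')" using that by auto
    ultimately show ?thesis by linarith
  qed
  \<comment> \<open>The factor 1 is the probability of the whole space; replacing it by
    \<open>prob D\<close> costs exactly \<open>?e\<close>, so that \<open>mult\<close> applies and
    the left side of \<open>indep\<close> appears.\<close>
  have "\<bar>prob (A \<inter> S) * 1 - prob (A \<inter> S \<inter> D) * prob D\<bar> \<le> 2 * ?e"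
    using near[of "A \<inter> S"] A S by (intro mult) auto
  moreover have "\<bar>prob A * prob S - prob (A \<inter> D) * prob (S \<inter> D)\<bar> \<le> 2 * ?e"
    using near[of A] near[of S] A S by (intro mult) auto
  ultimately show ?thesis using indep by (simp add: Int_ac)
qed

text \<open>As soon as \<open>m\<close> reaches \<open>l\<close>, the event that the state at time
  \<open>m\<close> is \<open>i\<close> separates the cylinder from the shifted event, and its
  probability is the \<open>i\<close>-th coordinate of the orbit at time \<open>m\<close>.\<close>

lemma mixing_cylinder:
  assumes M: "is_markov_measure n P x M"
    and lim: "(\<lambda>k. qso_orbit n P x k i) \<longlonglongrightarrow> 1" and i: "i \<in> {1..n}"
    and a: "a \<in> {0..l} \<rightarrow> {1..n}" and B: "B \<in> path_algebra n"
  shows "(\<lambda>m. measure M (cylinder n 0 l a \<inter> shift_preimage n m B)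
    - measure M (cylinder n 0 l a) * measure M (shift_preimage n m B)) \<longlonglongrightarrow> 0"
proof -
  interpret prob_space M using M by (simp add: is_markov_measure_def)
  have sets: "sets M = path_algebra n" using M by (auto simp: is_markov_measure_def)
  have D: "prob (cylinder n m m (\<lambda>_. i)) = qso_orbit n P x m i" for m
  proof -
    have "prob (cylinder n m m (\<lambda>_. i)) = qso_orbit n P x m i *
        (\<Prod>j\<in>{m..<m}. transition n P x j i i)"
      using M i unfolding is_markov_measure_def by auto
    then show ?thesis by simp
  qed
  have "\<forall>\<^sub>F m in sequentially. norm (measure M (cylinder n 0 l a \<inter> shift_preimage n m B)
    - measure M (cylinder n 0 l a) * measure M (shift_preimage n m B))
    \<le> 4 * (1 - qso_orbit n P x m i)"
    using eventually_ge_at_top[of l]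
  proof eventually_elim
    case (elim m)
    show ?case
      unfolding D[symmetric] real_norm_def
      by (intro correlation_le markov_property[OF M a elim B])
        (auto simp: sets cylinder_in_path_algebra shift_preimage_in_path_algebra[OF B])
  qed
  moreover have "(\<lambda>m. 4 * (1 - qso_orbit n P x m i)) \<longlonglongrightarrow> 0"
    using tendsto_mult_right_zero[OF LIM_zero[OF lim], of "-4"] by (simp add: algebra_simps)
  ultimately show ?thesis by (rule Lim_null_comparison)
qed

text \<open>For fixed \<open>B\<close>, the events \<open>A\<close> with vanishing correlation form
  a Dynkin system, which contains the cylinders from time 0 on.\<close>

lemma mixing:
  assumes M: "is_markov_measure n P x M"
    and lim: "(\<lambda>k. qso_orbit n P x k i) \<longlonglongrightarrow> 1" and i: "i \<in> {1..n}"
    and A: "A \<in> path_algebra n" and B: "B \<in> path_algebra n"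
  shows "(\<lambda>m. measure M (A \<inter> shift_preimage n m B)
    - measure M A * measure M (shift_preimage n m B)) \<longlonglongrightarrow> 0"
proof -
  interpret prob_space M using M by (simp add: is_markov_measure_def)
  have sets: "sets M = path_algebra n" and sp: "space M = path_set n"
    using M by (auto simp: is_markov_measure_def)
  let ?S = "\<lambda>m. shift_preimage n m B"
  have S: "?S m \<in> events" for m
    by (simp add: sets shift_preimage_in_path_algebra[OF B])
  from A show ?thesis
  proof (induction rule: path_algebra_induct)
    case (cylinder l a)
    then show ?case by (rule mixing_cylinder[OF M lim i _ B])
  next
    case empty
    then show ?case by simp
  next
    case (compl A)
    have A: "A \<in> events" using compl by (simp add: sets)
    \<comment> \<open>Passing to the complement only changes the sign of the correlation, since
      \<open>prob (?S m)\<close> cancels.\<close>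
    have "prob ((path_set n - A) \<inter> ?S m) - prob (path_set n - A) * prob (?S m) =
        - (prob (A \<inter> ?S m) - prob A * prob (?S m))" for m
    proof -
      have "(path_set n - A) \<inter> ?S m = ?S m - A \<inter> ?S m"
        by (auto simp: shift_preimage_def)
      then have "prob ((path_set n - A) \<inter> ?S m) = prob (?S m) - prob (A \<inter> ?S m)"
        using A S by (simp add: finite_measure_Diff)
      moreover have "prob (path_set n - A) = 1 - prob A"
        using prob_compl[OF A] by (simp add: sp)
      ultimately show ?thesis by (simp only: left_diff_distrib)
    qed
    then show ?case using tendsto_minus[OF compl(2)] by simp
  next
    case (union A)
    let ?d = "\<lambda>i m. prob (A i \<inter> ?S m) - prob (A i) * prob (?S m)"
    have A: "A i \<in> events" for i using union by (auto simp: sets)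
    have sumsA: "(\<lambda>i. prob (A i)) sums prob (\<Union>i. A i)"
      using A union(1) by (intro finite_measure_UNION) auto
    have sumsAS: "(\<lambda>i. prob (A i \<inter> ?S m)) sums prob ((\<Union>i. A i) \<inter> ?S m)" for m
      unfolding UN_simps(4)[symmetric] using A S union(1)
      by (intro finite_measure_UNION) (auto simp: disjoint_family_on_def, blast)
    have d: "(\<lambda>i. ?d i m) sums
        (prob ((\<Union>i. A i) \<inter> ?S m) - prob (\<Union>i. A i) * prob (?S m))" for m
      by (intro sums_diff sums_mult2 sumsA sumsAS)
    \<comment> \<open>Both terms of \<open>?d i m\<close> lie between 0 and
      \<open>prob (A i)\<close>, so their difference is dominated by it, independently of
      \<open>m\<close>.\<close>
    have bound: "norm (?d i m) \<le> prob (A i)" for i m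
    proof -
      have "prob (A i \<inter> ?S m) \<le> prob (A i)" using A by (intro finite_measure_mono) auto
      moreover have "prob (A i) * prob (?S m) \<le> prob (A i) * 1"
        by (intro mult_left_mono) auto
      ultimately show ?thesis by (auto simp: abs_le_iff) (smt (verit) measure_nonneg mult_nonneg_nonneg)+
    qed
    have "(\<lambda>m. \<Sum>i. ?d i m) \<longlonglongrightarrow> (\<Sum>i::nat. 0)"
    proof -
      \<comment> \<open>The disjoint sets \<open>A i\<close> have summable probabilities, so
        dominated convergence for series allows the limit in \<open>m\<close> to be taken inside the
        sum over \<open>i\<close>.\<close>
      have "\<forall>\<^sub>F (i, m) in at_top \<times>\<^sub>F sequentially. norm (?d i m) \<le> prob (A i)"
        using bound by (intro always_eventually) auto
      from tannerys_theorem[where a="?d", OF union(3) this sums_summable[OF sumsA]]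
      show ?thesis by simp
    qed
    then show ?case using d by (simp add: sums_iff)
  qed
qed

theorem theorem5p6:
  fixes n :: nat and P :: "nat \<Rightarrow> nat \<Rightarrow> nat \<Rightarrow> real" and x :: "nat \<Rightarrow> real"
    and A B :: "(nat \<Rightarrow> nat) set"
  assumes "1 \<le> n"
    and "heredity n P"
    and "b_bistochastic n (qso n P)"
    and "{y \<in> std_simplex n. qso n P y = y} = {last_vertex n}"
    and "x \<in> ri_simplex n"
    and "A \<in> path_algebra n" and "B \<in> path_algebra n"
  shows "(\<lambda>m. \<bar>measure (markov_measure n P x) (A \<inter> shift_preimage n m B)
              - measure (markov_measure n P x) A
                * measure (markov_measure n P x) (shift_preimage n m B)\<bar>) \<longlonglongrightarrow> 0"
proof -
  have x: "x \<in> std_simplex n" using assms(5) by (simp add: ri_simplex_def)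
  have n: "n \<in> {1..n}" using assms(1) by simp
  have "(\<lambda>k. qso_orbit n P x k n) \<longlonglongrightarrow> 1"
    using qso_orbit_tendsto_last_vertex[OF assms(2-4) x n] by (simp add: last_vertex_def)
  from mixing[OF is_markov_measure_markov_measure[OF assms(2) x] this n assms(6,7)]
  show ?thesis by (rule tendsto_rabs_zero)
qed

end
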